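(* Let $\{F_n\}_{n\ge 0}$ be the sequence defined by $F_0=F_1=1$ and $F_{n+2}=F_{n+1}+F_n$ for $n\ge 0$, and let $\beta=\frac{\sqrt5-1}{2}$. Then \[ \xi_1:=\prod_{n=1}^{\infty}\left(1+\frac{1}{F_n}\right)=2\beta^{-5/4}\frac{\vartheta_2(\beta)}{\vartheta_4(\beta^4)}, \qquad \xi_2:=\prod_{n=3}^{\infty}\left(1-\frac{1}{F_n}\right)=\frac{\sqrt5}{6}\beta^{-5/4}\frac{\vartheta_2(\beta)\vartheta_3(\beta)\vartheta_4(\beta)}{\vartheta_4(\beta^4)}. \]
   Context: The Jacobi theta functions are defined for complex $q$ with $|q|<1$ by $\vartheta_2(q)=2q^{1/4}\sum_{n=0}^{\infty}q^{n(n+1)}$, $\vartheta_3(q)=1+2\sum_{n=1}^{\infty}q^{n^2}$, $\vartheta_4(q)=1+2\sum_{n=1}^{\infty}(-1)^n q^{n^2}$. Here $\beta\in(0,1)$ and $q^{1/4}$, $\beta^{-5/4}$ denote the positive real powers.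
   Formalization: The initial value is corrected to F_0=0, F_1=1 (so F_1=F_2=1); with F_0=F_1=1 as printed both identities fail by a factor of 2 (the first product is about 6.575, while the right-hand side is about 13.151). *)

theory Defs
  imports "HOL-Analysis.Analysis"
begin

text \<open>
  Jacobi theta functions of the nome \<open>q\<close>, meaningful for \<open>norm q < 1\<close>.
  The fourth root is the principal one; it is the positive real root for \<open>q\<close> real and positive.
\<close>

definition jtheta2 :: "complex \<Rightarrow> complex" where
  "jtheta2 q = 2 * q powr (1/4) * (\<Sum>n. q ^ (n * (n + 1)))"

definition jtheta3 :: "complex \<Rightarrow> complex" where
  "jtheta3 q = 1 + 2 * (\<Sum>n. q ^ ((n + 1)\<^sup>2))"

definition jtheta4 :: "complex \<Rightarrow> complex" where
  "jtheta4 q = 1 + 2 * (\<Sum>n. (-1) ^ (n + 1) * q ^ ((n + 1)\<^sup>2))"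

end

theory Submission
  imports Defs
begin

text \<open>
  Put \<open>Q = \<beta>\<^sup>2 = 1 - \<beta>\<close>. Binet's formula together with \<open>\<surd>5 = \<beta>\<^sup>-\<^sup>1 + \<beta> = \<beta>\<^sup>-\<^sup>2 - \<beta>\<^sup>2\<close> makes the
  numerators of \<open>1 \<plusminus> 1/F\<^sub>n\<close> factor: for \<open>x = Q\<^sup>m\<close>,
  \<open>(1 + 1/F\<^sub>2\<^sub>m\<^sub>+\<^sub>1) (1 + 1/F\<^sub>2\<^sub>m\<^sub>+\<^sub>2) = (1 + x)\<^sup>2 (1 - Q\<^sup>2x) / ((1 + Qx\<^sup>2) (1 - Qx))\<close>,
  and changing the sign of \<open>x\<close> on the right gives the factors with \<open>1 - 1/F\<close>.
  After telescoping, the two products become quotients of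
  \<open>A = (-Q; Q)\<^sub>\<infinity>\<close>, \<open>B = (Q; Q)\<^sub>\<infinity>\<close> and \<open>D = (-Q; Q\<^sup>2)\<^sub>\<infinity>\<close>. The Jacobi triple product, obtained as
  the limit of the \<open>q\<close>-binomial theorem by Tannery's theorem, gives
  \<open>\<theta>\<^sub>2(\<beta>) = 2 \<beta>\<^sup>1\<^sup>/\<^sup>4 B A\<^sup>2\<close> and \<open>\<theta>\<^sub>4(\<beta>\<^sup>4) = B D\<close>, and with Euler's identity
  \<open>(-q\<^sup>2; q\<^sup>2)\<^sub>\<infinity> (q\<^sup>2; q\<^sup>4)\<^sub>\<infinity> = 1\<close> also \<open>\<theta>\<^sub>2(\<beta>) \<theta>\<^sub>3(\<beta>) \<theta>\<^sub>4(\<beta>) = 2 \<beta>\<^sup>1\<^sup>/\<^sup>4 B\<^sup>3\<close>.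
\<close>

subsection \<open>The \<open>q\<close>-binomial theorem\<close>

text \<open>Gaussian binomial coefficients, given by a \<open>q\<close>-Pascal rule so that no
  division occurs and any commutative ring is allowed. The quotient form is recovered in
  \<open>qfact_mult_qbinom\<close>.\<close>

fun qbinom :: "'a::comm_ring_1 \<Rightarrow> nat \<Rightarrow> nat \<Rightarrow> 'a" where
  "qbinom q n 0 = 1"
| "qbinom q 0 (Suc k) = 0"
| "qbinom q (Suc n) (Suc k) = q ^ Suc k * qbinom q n (Suc k) + qbinom q n k"

lemma qbinom_eq_0: "n < k \<Longrightarrow> qbinom q n k = 0"
  by (induction q n k rule: qbinom.induct) auto

text \<open>Peeling off the factor with \<open>k = 0\<close> leaves the same product at
  \<open>x * q\<close>, so the induction keeps \<open>x\<close> arbitrary. Comparing coefficients is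
  then exactly the recurrence of \<open>qbinom\<close>.\<close>

theorem q_binomial_theorem:
  fixes q x :: "'a::comm_ring_1"
  shows "(\<Prod>k<n. 1 + x * q ^ k) = (\<Sum>j\<le>n. qbinom q n j * q ^ (j choose 2) * x ^ j)"
proof (induction n arbitrary: x)
  case 0
  then show ?case by (simp add: numeral_2_eq_2)
next
  case (Suc n)
  define g where "g = (\<lambda>j. qbinom q n j * q ^ (j choose 2) * (x * q) ^ j)"
  have choose: "Suc j choose 2 = (j choose 2) + j" for j
    by (simp add: numeral_2_eq_2)
  have "(\<Prod>k<Suc n. 1 + x * q ^ k) = (1 + x) * (\<Prod>k<n. 1 + (x * q) * q ^ k)"
    by (subst prod.lessThan_Suc_shift) (simp add: mult.assoc)
  \<comment> \<open>The added term \<open>g (Suc n)\<close> is zero by \<open>qbinom_eq_0\<close>;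
    it makes room for the index shift.\<close>
  also have "\<dots> = (1 + x) * (\<Sum>j\<le>n. g j)"
    by (simp add: Suc.IH g_def)
  also have "\<dots> = (\<Sum>j\<le>Suc n. g j) + (\<Sum>j\<le>n. x * g j)"
    by (simp add: distrib_right sum_distrib_left g_def qbinom_eq_0 sum.distrib)
  also have "\<dots> = g 0 + (\<Sum>j\<le>n. g (Suc j) + x * g j)"
    by (subst sum.atMost_Suc_shift) (simp add: sum.distrib)
  also have "(\<Sum>j\<le>n. g (Suc j) + x * g j) =
      (\<Sum>j\<le>n. qbinom q (Suc n) (Suc j) * q ^ (Suc j choose 2) * x ^ Suc j)"
    by (intro sum.cong refl)
      (simp add: g_def choose algebra_simps power_mult_distrib power_add)
  also have "g 0 + \<dots> = (\<Sum>j\<le>Suc n. qbinom q (Suc n) j * q ^ (j choose 2) * x ^ j)"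
    by (subst sum.atMost_Suc_shift) (simp add: g_def numeral_2_eq_2)
  finally show ?case .
qed

text \<open>\<open>qfact q n\<close> is \<open>(q; q)\<^sub>n\<close>, without the customary division by \<open>(1 - q)\<^sup>n\<close>.\<close>

definition qfact :: "'a::comm_ring_1 \<Rightarrow> nat \<Rightarrow> 'a" where
  "qfact q n = (\<Prod>i<n. 1 - q ^ Suc i)"

lemma qfact_0 [simp]: "qfact q 0 = 1"
  and qfact_Suc: "qfact q (Suc n) = qfact q n * (1 - q ^ Suc n)"
  by (simp_all add: qfact_def)

text \<open>Both terms of the recurrence have index sum \<open>m\<close>, so the induction on
  \<open>i + j\<close> reduces each to \<open>qfact q m\<close>; the weights satisfy
  \<open>(1 - q^i) q^j + (1 - q^j) = 1 - q^(i+j)\<close>.\<close>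

lemma qfact_mult_qbinom: "qfact q j * qfact q i * qbinom q (i + j) j = qfact q (i + j)"
proof (induction "i + j" arbitrary: i j)
  case 0
  then show ?case by simp
next
  case (Suc m)
  show ?case
  proof (cases j)
    case 0
    then show ?thesis by simp
  next
    case j: (Suc j')
    show ?thesis
    proof (cases i)
      case 0
      have *: "qbinom q k k = 1" for k
        by (induction k) (auto simp: qbinom_eq_0)
      show ?thesis using 0 * by simp
    next
      case i: (Suc i')
      have "m = i' + j" "m = i + j'" using Suc.hyps i j by auto
      note IH = Suc.hyps(1)[OF this(1)] Suc.hyps(1)[OF this(2)]
      have "qfact q j * qfact q i * qbinom q (i + j) j =
         (1 - q ^ i) * q ^ j * (qfact q j * qfact q i' * qbinom q (i' + j) j)
         + (1 - q ^ j) * (qfact q j' * qfact q i * qbinom q (i + j') j')"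
        by (simp add: i j qfact_Suc algebra_simps)
      also have "\<dots> = (1 - q ^ i * q ^ j) * qfact q m"
        unfolding IH using \<open>m = i' + j\<close> \<open>m = i + j'\<close> by (simp add: algebra_simps)
      also have "\<dots> = qfact q (i + j)"
        using Suc.hyps(2) by (metis mult.commute power_add qfact_Suc)
      finally show ?thesis .
    qed
  qed
qed

section \<open>Finite form of the triple product\<close>

lemma sum_atMost_double:
  fixes f :: "nat \<Rightarrow> 'a::comm_monoid_add"
  shows "(\<Sum>j\<le>2 * n. f j) = f n + (\<Sum>k<n. f (n + Suc k) + f (n - Suc k))"
proof -
  have "(\<Sum>j\<le>2 * n. f j) = (\<Sum>j<n. f j) + (\<Sum>j=n..2 * n. f j)"
    by (subst sum.union_disjoint [symmetric]) (auto intro!: sum.cong)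
  also have "(\<Sum>j=n..2 * n. f j) = f n + (\<Sum>j=Suc n..2 * n. f j)"
    by (rule sum.atLeast_Suc_atMost) simp
  also have "(\<Sum>j=Suc n..2 * n. f j) = (\<Sum>k<n. f (n + Suc k))"
    by (rule sum.reindex_bij_witness[of _ "\<lambda>k. n + Suc k" "\<lambda>j. j - Suc n"]) auto
  also have "(\<Sum>j<n. f j) = (\<Sum>k<n. f (n - Suc k))"
    by (rule sum.nat_diff_reindex [symmetric])
  finally show ?thesis by (simp add: sum.distrib add_ac)
qed

text \<open>The long product runs over \<open>1 + z q^e\<close> for odd \<open>e\<close> from
  \<open>1 - 2n\<close> to \<open>2n - 1\<close>. Its upper half is the family in \<open>z\<close>;
  in the lower half, reversed, \<open>1 + z / q^e\<close> is turned into \<open>1 + q^e / z\<close>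
  by the monomial \<open>q^e / z\<close>.\<close>

lemma prod_triple_shift:
  fixes q z :: "'a::field"
  assumes "q \<noteq> 0" "z \<noteq> 0"
  shows "(\<Prod>k<n. (1 + z * q * (q\<^sup>2) ^ k) * (1 + q / z * (q\<^sup>2) ^ k)) =
    q ^ n\<^sup>2 / z ^ n * (\<Prod>k<2 * n. 1 + z * q / q ^ (2 * n) * (q\<^sup>2) ^ k)"
proof -
  \<comment> \<open>The exponents are the first \<open>n\<close> odd numbers, with sum
    \<open>n^2\<close>.\<close>
  have "(\<Prod>k<n. q * (q\<^sup>2) ^ k) = q ^ n\<^sup>2"
    by (induction n) (simp_all add: power2_eq_square power_add power_mult_distrib mult_ac)
  then have sq: "(\<Prod>k<n. q * (q\<^sup>2) ^ k / z) = q ^ n\<^sup>2 / z ^ n"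
    by (simp add: prod_dividef)
  let ?f = "\<lambda>k. 1 + z * q / q ^ (2 * n) * (q\<^sup>2) ^ k"
  have "(\<Prod>k<2 * n. ?f k) = (\<Prod>k<n. ?f k) * (\<Prod>k=n..<2 * n. ?f k)"
    by (subst prod.union_disjoint [symmetric]) (auto intro!: prod.cong)
  also have "(\<Prod>k=n..<2 * n. ?f k) = (\<Prod>k<n. ?f (n + k))"
    by (rule prod.reindex_bij_witness[of _ "\<lambda>k. n + k" "\<lambda>j. j - n"]) auto
  also have "\<dots> = (\<Prod>k<n. 1 + z * q * (q\<^sup>2) ^ k)"
    using assms by (intro prod.cong refl) (simp add: power_add power_mult)
  also have "(\<Prod>k<n. ?f k) = (\<Prod>k<n. ?f (n - Suc k))"
    by (rule prod.nat_diff_reindex [symmetric])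
  finally have "q ^ n\<^sup>2 / z ^ n * (\<Prod>k<2 * n. ?f k) =
     (\<Prod>k<n. (q * (q\<^sup>2) ^ k / z) * ?f (n - Suc k) * (1 + z * q * (q\<^sup>2) ^ k))"
    by (simp only: sq [symmetric] prod.distrib mult.assoc)
  also have "\<dots> = (\<Prod>k<n. (1 + z * q * (q\<^sup>2) ^ k) * (1 + q / z * (q\<^sup>2) ^ k))"
  proof (intro prod.cong refl)
    fix k assume "k \<in> {..<n}"
    then obtain d where d: "n = Suc k + d" by (metis add_Suc less_iff_Suc_add lessThan_iff)
    have "q ^ (2 * n) = q\<^sup>2 * (q\<^sup>2) ^ k * (q\<^sup>2) ^ (n - Suc k)"
      by (simp add: d power_mult power_add mult.assoc power2_eq_square)
    then have "z * q / q ^ (2 * n) * (q\<^sup>2) ^ (n - Suc k) = z / (q * (q\<^sup>2) ^ k)"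
      using assms by (simp add: power2_eq_square)
    moreover have "q * (q\<^sup>2) ^ k / z * (1 + z / (q * (q\<^sup>2) ^ k)) = 1 + q / z * (q\<^sup>2) ^ k"
      using assms by (simp add: distrib_left)
    ultimately show "(q * (q\<^sup>2) ^ k / z) * ?f (n - Suc k) * (1 + z * q * (q\<^sup>2) ^ k) =
       (1 + z * q * (q\<^sup>2) ^ k) * (1 + q / z * (q\<^sup>2) ^ k)"
      by (simp only: mult.commute)
  qed
  finally show ?thesis by simp
qed

text \<open>The \<open>q\<close>-binomial theorem with base \<open>q^2\<close> expands the shifted
  product. Centring the sum at \<open>j = n\<close> completes the square,
  \<open>n^2 + j^2 - 2nj = (j - n)^2\<close>, so the terms at distance \<open>i\<close> on either
  side share the factor \<open>q^(i^2)\<close>.\<close>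

lemma finite_triple_product:
  fixes q z :: "'a::field"
  assumes "q \<noteq> 0" "z \<noteq> 0"
  shows "(\<Prod>k<n. (1 + z * q * (q\<^sup>2) ^ k) * (1 + q / z * (q\<^sup>2) ^ k)) =
    qbinom (q\<^sup>2) (2 * n) n + (\<Sum>k<n. q ^ (Suc k)\<^sup>2 *
      (qbinom (q\<^sup>2) (2 * n) (n + Suc k) * z ^ Suc k + qbinom (q\<^sup>2) (2 * n) (n - Suc k) / z ^ Suc k))"
proof -
  define f where "f j = q ^ n\<^sup>2 / z ^ n *
     (qbinom (q\<^sup>2) (2 * n) j * (q\<^sup>2) ^ (j choose 2) * (z * q / q ^ (2 * n)) ^ j)" for j
  have f: "f j = qbinom (q\<^sup>2) (2 * n) j * (q ^ (n\<^sup>2 + j\<^sup>2) / q ^ (2 * n * j)) * (z ^ j / z ^ n)" for j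
  proof -
    have "even (j * (j - 1))" by (cases j) auto
    then have "2 * (j choose 2) + j = j\<^sup>2"
      by (cases j) (auto simp: choose_two power2_eq_square)
    then have "(q\<^sup>2) ^ (j choose 2) * q ^ j = q ^ j\<^sup>2"
      by (metis power_add power_mult)
    moreover have "f j = qbinom (q\<^sup>2) (2 * n) j *
        (q ^ n\<^sup>2 * ((q\<^sup>2) ^ (j choose 2) * q ^ j) / (q ^ (2 * n)) ^ j) * (z ^ j / z ^ n)"
      by (simp add: f_def power_mult_distrib power_divide mult_ac)
    ultimately show ?thesis
      by (simp only: power_add power_mult)
  qed
  have up: "f (n + i) = q ^ i\<^sup>2 * (qbinom (q\<^sup>2) (2 * n) (n + i) * z ^ i)" for i
  proof -
    have "n\<^sup>2 + (n + i)\<^sup>2 = 2 * n * (n + i) + i\<^sup>2"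
      by (simp add: power2_eq_square algebra_simps)
    then have "q ^ (n\<^sup>2 + (n + i)\<^sup>2) / q ^ (2 * n * (n + i)) = q ^ i\<^sup>2"
      using assms by (simp only: power_add) simp
    then show ?thesis using assms by (simp add: f power_add)
  qed
  have dn: "f (n - i) = q ^ i\<^sup>2 * (qbinom (q\<^sup>2) (2 * n) (n - i) / z ^ i)" if "i \<le> n" for i
  proof -
    obtain m where m: "n = i + m" using \<open>i \<le> n\<close> le_Suc_ex by blast
    have "n\<^sup>2 + (n - i)\<^sup>2 = 2 * n * (n - i) + i\<^sup>2"
      by (simp add: m power2_eq_square algebra_simps)
    then have "q ^ (n\<^sup>2 + (n - i)\<^sup>2) / q ^ (2 * n * (n - i)) = q ^ i\<^sup>2"
      using assms by (simp only: power_add) simp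
    moreover have "z ^ (n - i) / z ^ n = 1 / z ^ i"
      using assms by (simp add: m power_add)
    ultimately show ?thesis by (simp add: f)
  qed
  have "(\<Prod>k<n. (1 + z * q * (q\<^sup>2) ^ k) * (1 + q / z * (q\<^sup>2) ^ k)) = (\<Sum>j\<le>2 * n. f j)"
    unfolding prod_triple_shift[OF assms] q_binomial_theorem f_def sum_distrib_left ..
  also have "\<dots> = f n + (\<Sum>k<n. f (n + Suc k) + f (n - Suc k))"
    by (rule sum_atMost_double)
  also have "\<dots> = f n + (\<Sum>k<n. q ^ (Suc k)\<^sup>2 *
      (qbinom (q\<^sup>2) (2 * n) (n + Suc k) * z ^ Suc k + qbinom (q\<^sup>2) (2 * n) (n - Suc k) / z ^ Suc k))"
    by (intro arg_cong2[of _ _ _ _ "(+)"] sum.cong refl)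
       (simp only: up dn lessThan_iff Suc_le_eq distrib_left)
  also have "f n = qbinom (q\<^sup>2) (2 * n) n"
    using up[of 0] by simp
  finally show ?thesis .
qed


subsection \<open>Infinite \<open>q\<close>-products\<close>

text \<open>\<open>qpoch a q\<close> is \<open>(a; q)\<^sub>\<infinity>\<close>.\<close>

definition qpoch :: "'a::{real_normed_field,banach} \<Rightarrow> 'a \<Rightarrow> 'a" where
  "qpoch a q = (\<Prod>k. 1 - a * q ^ k)"

lemma convergent_prod_qpoch:
  fixes a q :: "'a::{real_normed_field,banach}"
  assumes "norm q < 1"
  shows "convergent_prod (\<lambda>k. 1 - a * q ^ k)"
proof (intro abs_convergent_prod_imp_convergent_prod summable_imp_abs_convergent_prod)
  show "summable (\<lambda>k. norm (1 - a * q ^ k - 1))"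
    using assms by (simp add: norm_mult norm_power summable_geometric summable_mult)
qed

lemma LIMSEQ_qpoch:
  fixes a q :: "'a::{real_normed_field,banach}"
  assumes "norm q < 1"
  shows "(\<lambda>n. \<Prod>k<n. 1 - a * q ^ k) \<longlonglongrightarrow> qpoch a q"
  unfolding qpoch_def
  using convergent_prod_qpoch[OF assms, THEN convergent_prod_has_prod] by (rule has_prod_imp_tendsto')

text \<open>A convergent product vanishes only if some factor does, and the two norm bounds keep
  every \<open>a * q ^ k\<close> away from 1.\<close>

lemma qpoch_nonzero:
  fixes a q :: "'a::{real_normed_field,banach}"
  assumes "norm q < 1" "norm a < 1"
  shows "qpoch a q \<noteq> 0"
  unfolding qpoch_def
proof (rule prodinf_nonzero[OF convergent_prod_qpoch[OF assms(1)]])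
  fix k
  have "norm q ^ k \<le> 1" using assms(1) by (simp add: power_le_one)
  then have "norm a * norm q ^ k \<le> norm a" by (simp add: mult_left_le)
  then have "norm (a * q ^ k) < 1"
    using assms(2) by (simp add: norm_mult norm_power)
  then show "1 - a * q ^ k \<noteq> 0" by auto
qed

lemma qpoch_mult_minus:
  fixes a q :: "'a::{real_normed_field,banach}"
  assumes "norm q < 1"
  shows "qpoch a q * qpoch (- a) q = qpoch (a\<^sup>2) (q\<^sup>2)"
proof (rule LIMSEQ_unique)
  have "norm (q\<^sup>2) < 1" using assms by (simp add: norm_power power_less_one_iff)
  then show "(\<lambda>n. \<Prod>k<n. 1 - a\<^sup>2 * (q\<^sup>2) ^ k) \<longlonglongrightarrow> qpoch (a\<^sup>2) (q\<^sup>2)"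
    by (rule LIMSEQ_qpoch)
  have "(\<lambda>n. (\<Prod>k<n. 1 - a * q ^ k) * (\<Prod>k<n. 1 - (- a) * q ^ k)) \<longlonglongrightarrow> qpoch a q * qpoch (- a) q"
    by (intro tendsto_mult LIMSEQ_qpoch assms)
  also have "(\<lambda>n. (\<Prod>k<n. 1 - a * q ^ k) * (\<Prod>k<n. 1 - (- a) * q ^ k)) =
      (\<lambda>n. \<Prod>k<n. 1 - a\<^sup>2 * (q\<^sup>2) ^ k)"
    unfolding prod.distrib [symmetric]
    by (simp add: algebra_simps power2_eq_square power_mult_distrib)
  finally show "(\<lambda>n. \<Prod>k<n. 1 - a\<^sup>2 * (q\<^sup>2) ^ k) \<longlonglongrightarrow> qpoch a q * qpoch (- a) q" .
qed

lemma prod_lessThan_double: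
  fixes f :: "nat \<Rightarrow> 'a::comm_monoid_mult"
  shows "(\<Prod>k<2 * n. f k) = (\<Prod>k<n. f (2 * k) * f (2 * k + 1))"
  by (induction n) (simp_all add: mult.assoc)

text \<open>Separates even from odd powers of \<open>q\<close>, by comparing with the partial
  products of even length.\<close>

lemma qpoch_dissect:
  fixes a q :: "'a::{real_normed_field,banach}"
  assumes "norm q < 1"
  shows "qpoch a (q\<^sup>2) * qpoch (a * q) (q\<^sup>2) = qpoch a q"
proof (rule LIMSEQ_unique)
  have "norm (q\<^sup>2) < 1" using assms by (simp add: norm_power power_less_one_iff)
  then have "(\<lambda>n. (\<Prod>k<n. 1 - a * (q\<^sup>2) ^ k) * (\<Prod>k<n. 1 - (a * q) * (q\<^sup>2) ^ k))
      \<longlonglongrightarrow> qpoch a (q\<^sup>2) * qpoch (a * q) (q\<^sup>2)"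
    by (intro tendsto_mult LIMSEQ_qpoch)
  also have "(\<lambda>n. (\<Prod>k<n. 1 - a * (q\<^sup>2) ^ k) * (\<Prod>k<n. 1 - (a * q) * (q\<^sup>2) ^ k)) =
      (\<lambda>n. \<Prod>k<2 * n. 1 - a * q ^ k)"
    by (simp add: prod_lessThan_double power_mult prod.distrib mult.assoc)
  finally show "(\<lambda>n. \<Prod>k<2 * n. 1 - a * q ^ k) \<longlonglongrightarrow> qpoch a (q\<^sup>2) * qpoch (a * q) (q\<^sup>2)" .
  show "(\<lambda>n. \<Prod>k<2 * n. 1 - a * q ^ k) \<longlonglongrightarrow> qpoch a q"
    using LIMSEQ_subseq_LIMSEQ[OF LIMSEQ_qpoch[OF assms], of "\<lambda>n. 2 * n"]
    by (simp add: strict_mono_def o_def)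
qed

lemma qpoch_rec:
  fixes a q :: "'a::{real_normed_field,banach}"
  assumes "norm q < 1"
  shows "qpoch a q = (1 - a) * qpoch (a * q) q"
proof (rule LIMSEQ_unique)
  show "(\<lambda>n. \<Prod>k<Suc n. 1 - a * q ^ k) \<longlonglongrightarrow> qpoch a q"
    using LIMSEQ_qpoch[OF assms] by (rule LIMSEQ_Suc)
  have "(\<lambda>n. (1 - a) * (\<Prod>k<n. 1 - a * q * q ^ k)) \<longlonglongrightarrow> (1 - a) * qpoch (a * q) q"
    by (intro tendsto_intros LIMSEQ_qpoch assms)
  then show "(\<lambda>n. \<Prod>k<Suc n. 1 - a * q ^ k) \<longlonglongrightarrow> (1 - a) * qpoch (a * q) q"
    by (simp add: prod.lessThan_Suc_shift mult.assoc del: prod.lessThan_Suc)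
qed

lemma qpoch_of_real:
  assumes "\<bar>q\<bar> < 1"
  shows "qpoch (complex_of_real a) (of_real q) = of_real (qpoch a q)"
proof (rule LIMSEQ_unique)
  show "(\<lambda>n. \<Prod>k<n. 1 - complex_of_real a * of_real q ^ k) \<longlonglongrightarrow> qpoch (of_real a) (of_real q)"
    using assms by (intro LIMSEQ_qpoch) simp
  have "(\<lambda>n. complex_of_real (\<Prod>k<n. 1 - a * q ^ k)) \<longlonglongrightarrow> of_real (qpoch a q)"
    using assms by (intro tendsto_of_real LIMSEQ_qpoch) simp
  then show "(\<lambda>n. \<Prod>k<n. 1 - complex_of_real a * of_real q ^ k) \<longlonglongrightarrow> of_real (qpoch a q)"
    by simp
qed

text \<open>Splitting \<open>qpoch (q^2) (q^2)\<close> by parity of the index, and then each half as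
  a difference of squares, gives back the same nonzero product times the left-hand side.\<close>

lemma qpoch_euler:
  fixes q :: "'a::{real_normed_field,banach}"
  assumes "norm q < 1"
  shows "qpoch (- (q\<^sup>2)) (q\<^sup>2) * qpoch (- q) (q\<^sup>2) * qpoch q (q\<^sup>2) = 1"
proof -
  have Q: "norm (q\<^sup>2) < 1" using assms by (simp add: norm_power power_less_one_iff)
  have "qpoch (q\<^sup>2) (q\<^sup>2) = qpoch (q\<^sup>2) ((q\<^sup>2)\<^sup>2) * qpoch ((q\<^sup>2)\<^sup>2) ((q\<^sup>2)\<^sup>2)"
    using qpoch_dissect[OF Q, of "q\<^sup>2"] by (simp add: power2_eq_square)
  also have "\<dots> = (qpoch q (q\<^sup>2) * qpoch (- q) (q\<^sup>2)) * (qpoch (q\<^sup>2) (q\<^sup>2) * qpoch (- (q\<^sup>2)) (q\<^sup>2))"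
    by (simp only: qpoch_mult_minus[OF Q])
  finally show ?thesis using qpoch_nonzero[OF Q Q] by (simp add: mult_ac)
qed

subsection \<open>The Jacobi triple product\<close>

lemma qfact_nonzero:
  fixes q :: "'a::real_normed_field"
  assumes "norm q < 1"
  shows "qfact q n \<noteq> 0"
proof -
  have "1 - q ^ Suc i \<noteq> 0" for i
  proof
    assume "1 - q ^ Suc i = 0"
    then have "norm q ^ Suc i = 1" by (metis eq_iff_diff_eq_0 norm_one norm_power)
    moreover have "norm q ^ Suc i < 1"
      using assms by (subst power_less_one_iff) auto
    ultimately show False by simp
  qed
  then show ?thesis by (simp add: qfact_def)
qed

lemma LIMSEQ_qfact:
  fixes q :: "'a::{real_normed_field,banach}"
  assumes "norm q < 1"
  shows "qfact q \<longlonglongrightarrow> qpoch q q"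
  using LIMSEQ_qpoch[OF assms, of q] by (simp add: qfact_def [abs_def])

lemma qbinom_eq_qfact:
  fixes q :: "'a::real_normed_field"
  assumes "norm q < 1"
  shows "qbinom q (i + j) j = qfact q (i + j) * inverse (qfact q i) * inverse (qfact q j)"
  using qfact_mult_qbinom[of q j i] qfact_nonzero[OF assms] by (simp add: field_simps)

text \<open>Provides the majorant for Tannery's theorem, uniformly in both indices:
  \<open>qfact q\<close> tends to a nonzero limit, so it and its reciprocal are bounded.\<close>

lemma qbinom_bounded:
  fixes q :: "'a::{real_normed_field,banach}"
  assumes "norm q < 1"
  obtains C where "C \<ge> 0" "\<And>n k. norm (qbinom q n k) \<le> C"
proof -
  note lim = LIMSEQ_qfact[OF assms]
  have "Bseq (qfact q)" using lim by (metis convergentI convergent_imp_Bseq)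
  then obtain K where K: "K > 0" "\<And>n. norm (qfact q n) \<le> K" by (auto elim: BseqE)
  have "Bseq (\<lambda>n. inverse (qfact q n))"
    using tendsto_inverse[OF lim qpoch_nonzero[OF assms assms]]
    by (metis convergentI convergent_imp_Bseq)
  then obtain L where L: "L > 0" "\<And>n. norm (inverse (qfact q n)) \<le> L" by (auto elim: BseqE)
  show ?thesis
  proof
    show "0 \<le> K * L * L" using K L by simp
    fix n k
    show "norm (qbinom q n k) \<le> K * L * L"
    proof (cases "k \<le> n")
      case True
      define i where "i = n - k"
      with True have "n = i + k" by simp
      then show ?thesis
        unfolding \<open>n = i + k\<close> qbinom_eq_qfact[OF assms] norm_mult
        using K L by (intro mult_mono) auto
    next
      case False
      then show ?thesis using K L by (simp add: qbinom_eq_0)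
    qed
  qed
qed

text \<open>Keeping \<open>i\<close> and \<open>j\<close> independent covers the central coefficient
  and those shifted by a fixed distance from the centre.\<close>

lemma tendsto_qbinom:
  fixes q :: "'a::{real_normed_field,banach}"
  assumes "norm q < 1" and i: "filterlim i at_top F" and j: "filterlim j at_top F"
  shows "((\<lambda>n. qbinom q (i n + j n) (j n)) \<longlongrightarrow> inverse (qpoch q q)) F"
proof -
  note lim = LIMSEQ_qfact[OF assms(1)] and nz = qpoch_nonzero[OF assms(1) assms(1)]
  have ij: "filterlim (\<lambda>n. i n + j n) at_top F"
    by (rule filterlim_at_top_mono[OF i]) simp
  have "((\<lambda>n. qfact q (i n + j n) * inverse (qfact q (i n)) * inverse (qfact q (j n)))
      \<longlongrightarrow> qpoch q q * inverse (qpoch q q) * inverse (qpoch q q)) F"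
    by (intro tendsto_mult tendsto_inverse nz filterlim_compose[OF lim] i j ij)
  then show ?thesis
    using nz by (simp add: qbinom_eq_qfact[OF assms(1)])
qed

text \<open>The ratio of consecutive terms is \<open>|q|^(2k) |q w|\<close>, which tends to 0 for
  every \<open>w\<close>; so the lemma serves \<open>z\<close> and \<open>1 / z\<close>
  alike.\<close>

lemma summable_norm_theta:
  fixes q w :: "'a::real_normed_field"
  assumes "norm q < 1"
  shows "summable (\<lambda>k. norm (q ^ k\<^sup>2 * w ^ k))"
proof -
  have "(\<lambda>k. ((norm q)\<^sup>2) ^ k * norm (q * w)) \<longlonglongrightarrow> 0 * norm (q * w)"
    using assms by (intro tendsto_intros LIMSEQ_power_zero) (simp add: power_less_one_iff)
  then have "\<forall>\<^sub>F k in sequentially. ((norm q)\<^sup>2) ^ k * norm (q * w) < 1 / 2"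
    by (rule order_tendstoD) simp
  then obtain N where N: "\<And>k. k \<ge> N \<Longrightarrow> ((norm q)\<^sup>2) ^ k * norm (q * w) < 1 / 2"
    by (auto simp: eventually_sequentially)
  show ?thesis
  proof (rule summable_ratio_test)
    fix k assume "k \<ge> N"
    have "norm (norm (q ^ (Suc k)\<^sup>2 * w ^ Suc k)) =
        ((norm q)\<^sup>2) ^ k * norm (q * w) * norm (norm (q ^ k\<^sup>2 * w ^ k))"
      by (simp add: norm_mult norm_power power2_eq_square power_add power_mult_distrib mult_ac)
    also have "\<dots> \<le> 1 / 2 * norm (norm (q ^ k\<^sup>2 * w ^ k))"
      using N[OF \<open>k \<ge> N\<close>] by (intro mult_right_mono) auto
    finally show "norm (norm (q ^ (Suc k)\<^sup>2 * w ^ Suc k)) \<le> 1 / 2 * norm (norm (q ^ k\<^sup>2 * w ^ k))" .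
  qed simp
qed

theorem jacobi_triple_product:
  fixes q z :: "'a::{real_normed_field,banach}"
  assumes q: "norm q < 1" "q \<noteq> 0" and z: "z \<noteq> 0"
  shows "qpoch (q\<^sup>2) (q\<^sup>2) * qpoch (- (z * q)) (q\<^sup>2) * qpoch (- (q / z)) (q\<^sup>2) =
    1 + (\<Sum>k. q ^ (k + 1)\<^sup>2 * (z ^ (k + 1) + 1 / z ^ (k + 1)))"
proof -
  let ?Q = "q\<^sup>2"
  have Q: "norm ?Q < 1" using q by (simp add: norm_power power_less_one_iff)
  define R where "R = qpoch ?Q ?Q"
  have "R \<noteq> 0" unfolding R_def by (rule qpoch_nonzero[OF Q Q])
  \<comment> \<open>Padding with zeros turns the finite sums into series over one index set, as
    Tannery's theorem requires; \<open>b k\<close> is the limit of \<open>a k n\<close> in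
    \<open>n\<close>, and \<open>M k\<close> dominates it.\<close>
  define a where "a k n = (if k < n then q ^ (Suc k)\<^sup>2 *
      (qbinom ?Q (2 * n) (n + Suc k) * z ^ Suc k + qbinom ?Q (2 * n) (n - Suc k) / z ^ Suc k) else 0)" for k n
  define b where "b k = inverse R * (q ^ (Suc k)\<^sup>2 * (z ^ Suc k + 1 / z ^ Suc k))" for k
  obtain C where C: "C \<ge> 0" "\<And>n k. norm (qbinom ?Q n k) \<le> C"
    using qbinom_bounded[OF Q] by blast
  define M where "M k = C * norm (q ^ (Suc k)\<^sup>2 * z ^ Suc k) + C * norm (q ^ (Suc k)\<^sup>2 * (1 / z) ^ Suc k)" for k
  have "summable M"
    unfolding M_def
    by (intro summable_add summable_mult summable_Suc_iff[THEN iffD2] summable_norm_theta q)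
  have bound: "norm (a k n) \<le> M k" for k n
  proof (cases "k < n")
    case True
    have "norm (a k n) \<le> norm (qbinom ?Q (2 * n) (n + Suc k)) * norm (q ^ (Suc k)\<^sup>2 * z ^ Suc k)
        + norm (qbinom ?Q (2 * n) (n - Suc k)) * norm (q ^ (Suc k)\<^sup>2 * (1 / z) ^ Suc k)"
      unfolding norm_mult [symmetric]
      by (rule order_trans[OF _ norm_triangle_ineq]) (use True in \<open>simp add: a_def algebra_simps power_divide\<close>)
    also have "\<dots> \<le> M k"
      unfolding M_def using C by (intro add_mono mult_right_mono) auto
    finally show ?thesis .
  qed (use C in \<open>simp add: a_def M_def\<close>)
  have ev: "\<forall>\<^sub>F n in sequentially. k < n" for k :: nat
    by (rule eventually_gt_at_top)
  have minus: "filterlim (\<lambda>n. n - k) at_top sequentially" for k :: nat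
    by (rule filterlim_minus_const_nat_at_top)
  have plus: "filterlim (\<lambda>n. n + k) at_top sequentially" for k :: nat
    by (rule filterlim_at_top_mono[OF filterlim_ident]) simp
  have mid: "(\<lambda>n. qbinom ?Q (2 * n) n) \<longlonglongrightarrow> inverse R"
    using tendsto_qbinom[OF Q filterlim_ident filterlim_ident] by (simp add: R_def mult_2)
  \<comment> \<open>The splitting \<open>2 * n = (n - Suc k) + (n + Suc k)\<close> holds for natural
    subtraction only once \<open>k < n\<close>, hence the passage through an eventual
    equality.\<close>
  have up: "(\<lambda>n. qbinom ?Q (2 * n) (n + Suc k)) \<longlonglongrightarrow> inverse R" for k
    using tendsto_qbinom[OF Q minus[of "Suc k"] plus[of "Suc k"]] unfolding R_def
    by (rule Lim_transform_eventually) (use ev[of k] in eventually_elim, simp add: mult_2)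
  have dn: "(\<lambda>n. qbinom ?Q (2 * n) (n - Suc k)) \<longlonglongrightarrow> inverse R" for k
    using tendsto_qbinom[OF Q plus[of "Suc k"] minus[of "Suc k"]] unfolding R_def
    by (rule Lim_transform_eventually) (use ev[of k] in eventually_elim, simp add: mult_2)
  have lim: "(\<lambda>n. a k n) \<longlonglongrightarrow> b k" for k
  proof (rule Lim_transform_eventually)
    have b: "b k = q ^ (Suc k)\<^sup>2 * (inverse R * z ^ Suc k + inverse R / z ^ Suc k)"
      by (simp add: b_def algebra_simps)
    show "(\<lambda>n. q ^ (Suc k)\<^sup>2 * (qbinom ?Q (2 * n) (n + Suc k) * z ^ Suc k
        + qbinom ?Q (2 * n) (n - Suc k) / z ^ Suc k)) \<longlonglongrightarrow> b k"
      unfolding b using z by (intro tendsto_intros up dn) simp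
    show "\<forall>\<^sub>F n in sequentially. q ^ (Suc k)\<^sup>2 * (qbinom ?Q (2 * n) (n + Suc k) * z ^ Suc k
        + qbinom ?Q (2 * n) (n - Suc k) / z ^ Suc k) = a k n"
      using ev[of k] by eventually_elim (simp add: a_def)
  qed
  have tannery: "summable (\<lambda>k. norm (b k)) \<and> (\<lambda>n. \<Sum>k. a k n) \<longlonglongrightarrow> (\<Sum>k. b k)"
    using tannerys_theorem[of a b sequentially M, OF lim _ \<open>summable M\<close>] bound
    by (auto intro: always_eventually)
  have fin: "(\<Prod>k<n. (1 + z * q * ?Q ^ k) * (1 + q / z * ?Q ^ k)) =
      qbinom ?Q (2 * n) n + (\<Sum>k. a k n)" for n
  proof -
    have "(\<Sum>k. a k n) = (\<Sum>k<n. a k n)"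
      by (rule suminf_finite) (auto simp: a_def)
    then show ?thesis
      unfolding finite_triple_product[OF q(2) z] by (simp add: a_def)
  qed
  have "(\<lambda>n. \<Prod>k<n. (1 + z * q * ?Q ^ k) * (1 + q / z * ?Q ^ k)) \<longlonglongrightarrow> inverse R + (\<Sum>k. b k)"
    unfolding fin by (intro tendsto_add mid conjunct2[OF tannery])
  moreover have "(\<lambda>n. \<Prod>k<n. (1 + z * q * ?Q ^ k) * (1 + q / z * ?Q ^ k)) \<longlonglongrightarrow>
      qpoch (- (z * q)) ?Q * qpoch (- (q / z)) ?Q"
    using tendsto_mult[OF LIMSEQ_qpoch[OF Q, of "- (z * q)"] LIMSEQ_qpoch[OF Q, of "- (q / z)"]]
    by (simp add: prod.distrib)
  ultimately have "qpoch (- (z * q)) ?Q * qpoch (- (q / z)) ?Q = inverse R + (\<Sum>k. b k)"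
    by (rule LIMSEQ_unique [rotated])
  moreover have "R * (\<Sum>k. b k) = (\<Sum>k. q ^ (k + 1)\<^sup>2 * (z ^ (k + 1) + 1 / z ^ (k + 1)))"
  proof -
    have "summable b" using tannery summable_norm_cancel by blast
    then have "R * (\<Sum>k. b k) = (\<Sum>k. R * b k)" by (rule suminf_mult [symmetric])
    also have "(\<lambda>k. R * b k) = (\<lambda>k. q ^ (k + 1)\<^sup>2 * (z ^ (k + 1) + 1 / z ^ (k + 1)))"
      using \<open>R \<noteq> 0\<close> by (simp add: b_def flip: mult.assoc)
    finally show ?thesis .
  qed
  ultimately show ?thesis
    using \<open>R \<noteq> 0\<close> by (simp add: R_def [symmetric] mult.assoc distrib_left)
qed

subsection \<open>Product formulas for the theta functions\<close>

text \<open>The triple product at \<open>z = q\<close>. Its series has exponents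
  \<open>(k+1)(k+2)\<close> and \<open>k(k+1)\<close>, so with the leading 1 it counts the theta
  series \<open>s\<close> twice. The factor with \<open>q / z = 1\<close> supplies the matching
  2.\<close>

lemma jtheta2_product:
  assumes "norm q < 1" "q \<noteq> 0"
  shows "jtheta2 q = 2 * q powr (1/4) * (qpoch (q\<^sup>2) (q\<^sup>2) * (qpoch (- (q\<^sup>2)) (q\<^sup>2))\<^sup>2)"
proof -
  have Q: "norm (q\<^sup>2) < 1" using assms by (simp add: norm_power power_less_one_iff)
  define s where "s = (\<Sum>k. q ^ (k * (k + 1)))"
  have sm: "summable (\<lambda>k. q ^ (k * (k + 1)))"
    using summable_norm_cancel[OF summable_norm_theta[OF assms(1), of q]]
    by (simp add: power2_eq_square add.commute flip: power_add)
  have eq: "q ^ (k + 1)\<^sup>2 * (q ^ (k + 1) + 1 / q ^ (k + 1)) = q ^ (Suc k * (Suc k + 1)) + q ^ (k * (k + 1))" for k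
    using assms(2) by (simp add: field_simps power2_eq_square flip: power_add)
  have "qpoch (q\<^sup>2) (q\<^sup>2) * qpoch (- (q\<^sup>2)) (q\<^sup>2) * qpoch (- 1) (q\<^sup>2) =
      1 + (\<Sum>k. q ^ (Suc k * (Suc k + 1)) + q ^ (k * (k + 1)))"
    using jacobi_triple_product[OF assms assms(2)] assms(2) unfolding eq by (simp add: power2_eq_square)
  also have "\<dots> = 1 + ((\<Sum>k. q ^ (Suc k * (Suc k + 1))) + s)"
    unfolding s_def
    by (subst suminf_add) (use sm summable_Suc_iff[of "\<lambda>k. q ^ (k * (k + 1))"] in auto)
  also have "(\<Sum>k. q ^ (Suc k * (Suc k + 1))) = s - 1"
    using suminf_split_head[OF sm] by (simp add: s_def)
  also have "qpoch (- 1) (q\<^sup>2) = 2 * qpoch (- (q\<^sup>2)) (q\<^sup>2)"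
    using qpoch_rec[OF Q, of "- 1"] by simp
  finally have "s = qpoch (q\<^sup>2) (q\<^sup>2) * (qpoch (- (q\<^sup>2)) (q\<^sup>2))\<^sup>2"
    by (simp add: power2_eq_square)
  then show ?thesis by (simp add: jtheta2_def s_def)
qed

text \<open>The triple product at \<open>z = 1\<close>; \<open>jtheta4_product\<close> is the case
  \<open>z = - 1\<close>.\<close>

lemma jtheta3_product:
  assumes "norm q < 1" "q \<noteq> 0"
  shows "jtheta3 q = qpoch (q\<^sup>2) (q\<^sup>2) * (qpoch (- q) (q\<^sup>2))\<^sup>2"
proof -
  have "summable (\<lambda>k. q ^ (k + 1)\<^sup>2)"
    using summable_norm_cancel[OF summable_norm_theta[OF assms(1), of 1]]
      summable_Suc_iff[of "\<lambda>k. q ^ k\<^sup>2"] by simp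
  then have "(\<Sum>k. q ^ (k + 1)\<^sup>2 * 2) = 2 * (\<Sum>k. q ^ (k + 1)\<^sup>2)"
    by (subst suminf_mult2 [symmetric]) auto
  then show ?thesis
    using jacobi_triple_product[OF assms, of 1] by (simp add: jtheta3_def power2_eq_square mult.assoc)
qed

lemma jtheta4_product:
  assumes "norm q < 1" "q \<noteq> 0"
  shows "jtheta4 q = qpoch (q\<^sup>2) (q\<^sup>2) * (qpoch q (q\<^sup>2))\<^sup>2"
proof -
  have eq: "q ^ (k + 1)\<^sup>2 * ((- 1) ^ (k + 1) + 1 / (- 1) ^ (k + 1)) =
      2 * ((- 1) ^ (k + 1) * q ^ (k + 1)\<^sup>2)" for k
    by (cases "even k") auto
  have "summable (\<lambda>k. (- 1) ^ (k + 1) * q ^ (k + 1)\<^sup>2)"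
    using summable_norm_cancel[OF summable_norm_theta[OF assms(1), of "- 1"]]
      summable_Suc_iff[of "\<lambda>k. q ^ k\<^sup>2 * (- 1) ^ k"] by (simp add: mult.commute)
  then have "(\<Sum>k. q ^ (k + 1)\<^sup>2 * ((- 1) ^ (k + 1) + 1 / (- 1) ^ (k + 1))) =
      2 * (\<Sum>k. (- 1) ^ (k + 1) * q ^ (k + 1)\<^sup>2)"
    unfolding eq by (rule suminf_mult)
  then show ?thesis
    using jacobi_triple_product[OF assms, of "- 1"] by (simp add: jtheta4_def power2_eq_square mult.assoc)
qed

text \<open>Rewrites the formula for base \<open>Q^2\<close> so that the factor
  \<open>qpoch Q Q\<close>, common to the other theta products, appears: one copy of
  \<open>qpoch (Q^2) (Q^4)\<close> is merged into \<open>qpoch (Q^2) (Q^2)\<close>, the other is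
  split as a difference of squares.\<close>

lemma jtheta4_power4_product:
  assumes "norm q < 1" "q \<noteq> 0"
  shows "jtheta4 (q ^ 4) = qpoch (q\<^sup>2) (q\<^sup>2) * qpoch (- (q\<^sup>2)) ((q\<^sup>2)\<^sup>2)"
proof -
  define Q where "Q = q\<^sup>2"
  have Q: "norm Q < 1" using assms by (simp add: Q_def norm_power power_less_one_iff)
  then have Q2: "norm (Q\<^sup>2) < 1" by (simp add: norm_power power_less_one_iff)
  have q4: "q ^ 4 = Q\<^sup>2" by (simp add: Q_def flip: power_mult)
  have "jtheta4 (q ^ 4) = qpoch ((Q\<^sup>2)\<^sup>2) ((Q\<^sup>2)\<^sup>2) * (qpoch (Q\<^sup>2) ((Q\<^sup>2)\<^sup>2))\<^sup>2"
    unfolding q4 using assms by (intro jtheta4_product Q2) (simp add: Q_def)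
  also have "\<dots> = qpoch (Q\<^sup>2) (Q\<^sup>2) * qpoch (Q\<^sup>2) ((Q\<^sup>2)\<^sup>2)"
    using qpoch_dissect[OF Q2, of "Q\<^sup>2"] by (simp add: power2_eq_square mult_ac)
  also have "qpoch (Q\<^sup>2) ((Q\<^sup>2)\<^sup>2) = qpoch Q (Q\<^sup>2) * qpoch (- Q) (Q\<^sup>2)"
    by (rule qpoch_mult_minus[OF Q2, symmetric])
  also have "qpoch (Q\<^sup>2) (Q\<^sup>2) * \<dots> = qpoch Q Q * qpoch (- Q) (Q\<^sup>2)"
    using qpoch_dissect[OF Q, of Q] by (simp add: power2_eq_square mult_ac)
  finally show ?thesis by (simp add: Q_def)
qed

text \<open>Apart from the cube, the three formulas contribute exactly the square of Euler's
  product.\<close>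

lemma jtheta234_product:
  assumes "norm q < 1" "q \<noteq> 0"
  shows "jtheta2 q * jtheta3 q * jtheta4 q = 2 * q powr (1/4) * qpoch (q\<^sup>2) (q\<^sup>2) ^ 3"
proof -
  have "jtheta2 q * jtheta3 q * jtheta4 q = 2 * q powr (1/4) * qpoch (q\<^sup>2) (q\<^sup>2) ^ 3 *
      (qpoch (- (q\<^sup>2)) (q\<^sup>2) * qpoch (- q) (q\<^sup>2) * qpoch q (q\<^sup>2))\<^sup>2"
    unfolding jtheta2_product[OF assms] jtheta3_product[OF assms] jtheta4_product[OF assms]
    by (simp add: power2_eq_square power3_eq_cube mult_ac)
  then show ?thesis by (simp add: qpoch_euler[OF assms(1)])
qed

subsection \<open>The Fibonacci products\<close>

text \<open>Fibonacci factors simplify only in pairs; as convergence is shown separately, partial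
  products of even length determine the value.\<close>

lemma prodinf_eqI_even_partial_products:
  fixes f :: "nat \<Rightarrow> real"
  assumes "convergent_prod f" "(\<lambda>n. \<Prod>k<2 * n. f k) \<longlonglongrightarrow> L"
  shows "prodinf f = L"
proof (rule LIMSEQ_unique)
  show "(\<lambda>n. \<Prod>k<2 * n. f k) \<longlonglongrightarrow> prodinf f"
    using LIMSEQ_subseq_LIMSEQ[OF has_prod_imp_tendsto'[OF convergent_prod_has_prod[OF assms(1)]],
        of "\<lambda>n. 2 * n"]
    by (simp add: strict_mono_def o_def)
qed fact

lemma power_minus_odd_eq: "(- x) ^ (2 * m + 1) = - (x * (x ^ m)\<^sup>2)"
  and power_minus_even_eq: "(- x) ^ (2 * m + 2) = (x * x ^ m)\<^sup>2" for x :: "'a::comm_ring_1"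
proof -
  have "(- x) ^ (2 * m) = (x ^ m)\<^sup>2"
    by (subst power_minus_even) (simp_all only: power_even_eq dvd_triv_left)
  then show "(- x) ^ (2 * m + 1) = - (x * (x ^ m)\<^sup>2)" "(- x) ^ (2 * m + 2) = (x * x ^ m)\<^sup>2"
    by (simp_all add: power2_eq_square mult_ac)
qed

text \<open>With these initial values \<open>F 1 = F 2 = 1\<close>, so \<open>1 - 1 / F n\<close>
  vanishes at \<open>n = 1\<close> and \<open>n = 2\<close>, and the product with minus signs starts
  at \<open>n = 3\<close>.\<close>

locale golden_fib =
  fixes F :: "nat \<Rightarrow> nat" and q :: real
  assumes F0: "F 0 = 0" and F1: "F 1 = 1" and F_rec: "\<And>n. F (n + 2) = F (n + 1) + F n"
    and q_def: "q = (sqrt 5 - 1) / 2"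
begin

lemma q_sq: "q\<^sup>2 = 1 - q"
  by (simp add: q_def power2_eq_square field_simps)

lemma q_pos: "0 < q" and q_less_1: "q < 1"
proof -
  have "sqrt 5 < sqrt 9" "sqrt 1 < sqrt 5" by (simp_all only: real_sqrt_less_iff)
  moreover have "sqrt 9 = (3::real)" by (simp add: real_sqrt_unique)
  ultimately show "0 < q" "q < 1" by (simp_all add: q_def)
qed

text \<open>Binet's formula with cleared denominators: the roots of \<open>x^2 = x + 1\<close> are
  \<open>1 / q\<close> and \<open>- q\<close>, with difference \<open>(1 + q^2) / q\<close>. The
  induction step rests on \<open>q + q^2 = 1\<close>.\<close>

lemma binet: "real (F n) * ((1 + q\<^sup>2) * q ^ n) = q * (1 - (- (q\<^sup>2)) ^ n)"
proof (induction n rule: induct_nat_012)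
  case 0
  then show ?case using F0 by simp
next
  case 1
  then show ?case using F1 by simp
next
  case (ge2 n)
  have "real (F (Suc (Suc n))) * ((1 + q\<^sup>2) * q ^ Suc (Suc n)) =
      q * (real (F (Suc n)) * ((1 + q\<^sup>2) * q ^ Suc n)) + q\<^sup>2 * (real (F n) * ((1 + q\<^sup>2) * q ^ n))"
    using F_rec[of n] by (simp add: algebra_simps power2_eq_square)
  also have "\<dots> = q * (q * (1 - (- (q\<^sup>2)) ^ Suc n)) + q\<^sup>2 * (q * (1 - (- (q\<^sup>2)) ^ n))"
    unfolding ge2 ..
  also have "\<dots> = q * ((q + q\<^sup>2) - (- (q\<^sup>2)) ^ n * (q\<^sup>2 * (1 - q)))"
    by (simp add: algebra_simps power2_eq_square)
  also have "\<dots> = q * (1 - (- (q\<^sup>2)) ^ n * (q\<^sup>2 * q\<^sup>2))"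
    by (simp add: q_sq)
  also have "\<dots> = q * (1 - (- (q\<^sup>2)) ^ Suc (Suc n))"
    by simp
  finally show ?case .
qed

lemma F_pos: "F (Suc n) > 0"
  by (induction n rule: induct_nat_012) (use F1 F_rec in auto)

section \<open>Fibonacci reciprocals and paired factors in powers of \<open>Q\<close>\<close>

definition Q :: real where "Q = q\<^sup>2"

lemma Q_eq: "Q = 1 - q"
  by (simp add: Q_def q_sq)

lemma q_power_even: "q ^ (2 * m) = Q ^ m"
  by (simp add: Q_def power_mult)

lemmas binet_Q = binet[folded Q_def]

lemma Q_pos: "0 < Q" and Q_less_1: "Q < 1"
  using q_pos q_less_1 by (simp_all add: Q_eq)

lemma Q_power_bounds: "0 < Q ^ m" "Q ^ m \<le> 1" "Q * Q ^ m < 1"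
  using Q_pos Q_less_1 power_less_one_iff[of Q "Suc m"]
  by (simp_all add: power_le_one)

lemma inverse_F_odd: "1 / real (F (2 * m + 1)) = (1 + Q) * Q ^ m / (1 + Q * (Q ^ m)\<^sup>2)"
proof -
  have "(- Q) ^ (2 * m + 1) = - (Q * (Q ^ m)\<^sup>2)"
    by (rule power_minus_odd_eq)
  then have "real (F (2 * m + 1)) * ((1 + Q) * Q ^ m) = 1 + Q * (Q ^ m)\<^sup>2"
    using binet_Q[of "2 * m + 1"] q_pos by (simp add: q_power_even mult.left_commute)
  moreover have "1 + Q * (Q ^ m)\<^sup>2 > 0" using Q_pos by (intro add_pos_nonneg) auto
  ultimately show ?thesis using F_pos[of "2 * m"] by (simp add: field_simps)
qed

text \<open>Unlike for odd indices, one factor \<open>q\<close> survives in Binet's formula; it is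
  absorbed by \<open>(1 + Q) * q = 1 - Q^2\<close>, since \<open>q = 1 - Q\<close>.\<close>

lemma inverse_F_even: "1 / real (F (2 * m + 2)) = (1 - Q\<^sup>2) * Q ^ m / (1 - (Q * Q ^ m)\<^sup>2)"
proof -
  have "(- Q) ^ (2 * m + 2) = (Q * Q ^ m)\<^sup>2"
    by (rule power_minus_even_eq)
  then have "real (F (2 * m + 2)) * ((1 + Q) * (q * Q ^ m)) = 1 - (Q * Q ^ m)\<^sup>2"
    using binet_Q[of "2 * m + 2"] q_pos by (simp add: q_power_even mult.left_commute)
  moreover have "(1 + Q) * q = 1 - Q\<^sup>2"
    unfolding Q_eq by (simp add: algebra_simps power2_eq_square)
  ultimately have "real (F (2 * m + 2)) * ((1 - Q\<^sup>2) * Q ^ m) = 1 - (Q * Q ^ m)\<^sup>2"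
    by (simp add: mult.assoc [symmetric])
  moreover have "(Q * Q ^ m)\<^sup>2 < 1"
    using Q_power_bounds[of m] Q_pos by (simp add: power_less_one_iff)
  ultimately show ?thesis using F_pos[of "2 * m + 1"] by (simp add: field_simps)
qed

text \<open>With \<open>x = Q ^ m\<close> the numerators are \<open>(1 + x)(1 + Qx)\<close> and
  \<open>(1 + x)(1 - Q^2 x)\<close>. The factor \<open>1 + Qx\<close> cancels against the even
  denominator, and what remains beside the square telescopes in \<open>m\<close>.\<close>

lemma fib_factor_plus:
  "(1 + 1 / real (F (2 * m + 1))) * (1 + 1 / real (F (2 * m + 2))) =
    (1 + Q ^ m)\<^sup>2 / (1 + Q * (Q ^ m)\<^sup>2) * ((1 - Q * (Q * Q ^ m)) / (1 - Q * Q ^ m))"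
proof -
  define x where "x = Q ^ m"
  have x: "0 < x" "Q * x < 1" using Q_power_bounds[of m] by (simp_all add: x_def)
  have nz: "1 + Q * x\<^sup>2 \<noteq> 0" "1 - Q * x \<noteq> 0" "1 + Q * x \<noteq> 0"
    using x Q_pos by (auto simp: add_nonneg_eq_0_iff)
  have sq: "1 - (Q * x)\<^sup>2 = (1 - Q * x) * (1 + Q * x)"
    by (simp add: algebra_simps power2_eq_square)
  have "1 + (1 + Q) * x / (1 + Q * x\<^sup>2) = (1 + x) * (1 + Q * x) / (1 + Q * x\<^sup>2)"
    using nz by (simp add: field_simps power2_eq_square)
  moreover have "1 + (1 - Q\<^sup>2) * x / (1 - (Q * x)\<^sup>2) = (1 + x) * (1 - Q * (Q * x)) / ((1 - Q * x) * (1 + Q * x))"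
    unfolding sq using nz by (simp add: divide_simps) (simp add: algebra_simps power2_eq_square)
  ultimately show ?thesis
    unfolding inverse_F_odd inverse_F_even x_def [symmetric] using nz by (simp add: power2_eq_square)
qed

text \<open>Here the cancelling factor is \<open>1 - Qx\<close>.\<close>

lemma fib_factor_minus:
  "(1 - 1 / real (F (2 * m + 1))) * (1 - 1 / real (F (2 * m + 2))) =
    (1 - Q ^ m)\<^sup>2 / (1 + Q * (Q ^ m)\<^sup>2) * ((1 + Q * (Q * Q ^ m)) / (1 + Q * Q ^ m))"
proof -
  define x where "x = Q ^ m"
  have x: "0 < x" "Q * x < 1" using Q_power_bounds[of m] by (simp_all add: x_def)
  have nz: "1 + Q * x\<^sup>2 \<noteq> 0" "1 - Q * x \<noteq> 0" "1 + Q * x \<noteq> 0"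
    using x Q_pos by (auto simp: add_nonneg_eq_0_iff)
  have sq: "1 - (Q * x)\<^sup>2 = (1 - Q * x) * (1 + Q * x)"
    by (simp add: algebra_simps power2_eq_square)
  have "1 - (1 + Q) * x / (1 + Q * x\<^sup>2) = (1 - x) * (1 - Q * x) / (1 + Q * x\<^sup>2)"
    using nz by (simp add: field_simps power2_eq_square)
  moreover have "1 - (1 - Q\<^sup>2) * x / (1 - (Q * x)\<^sup>2) = (1 - x) * (1 + Q * (Q * x)) / ((1 - Q * x) * (1 + Q * x))"
    unfolding sq using nz by (simp add: divide_simps) (simp add: algebra_simps power2_eq_square)
  ultimately show ?thesis
    unfolding inverse_F_odd inverse_F_even x_def [symmetric] using nz by (simp add: power2_eq_square)
qed

section \<open>Convergence and evaluation of the Fibonacci products\<close>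

lemma summable_inverse_fib: "summable (\<lambda>n. 1 / real (F (n + 1)))"
proof (rule summable_comparison_test')
  show "summable (\<lambda>n. (1 + Q) / (1 - Q) * q ^ n)"
    using q_pos q_less_1 by (intro summable_mult summable_geometric) simp
  \<comment> \<open>The oscillating term in Binet's formula is at most \<open>Q\<close>, so
    \<open>F (n + 1)\<close> grows at least like a constant times \<open>q^(-n)\<close>.\<close>
  fix n
  have "(- Q) ^ (n + 1) \<le> \<bar>(- Q) ^ (n + 1)\<bar>" by (rule abs_ge_self)
  also have "\<dots> \<le> Q"
    using Q_pos Q_less_1 by (simp add: power_abs abs_mult mult_left_le power_le_one)
  finally have "1 - Q \<le> real (F (n + 1)) * ((1 + Q) * q ^ n)"
    using binet_Q[of "n + 1"] q_pos by (simp add: mult.left_commute)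
  then have "1 / real (F (n + 1)) \<le> (1 + Q) / (1 - Q) * q ^ n"
    using F_pos[of n] Q_less_1 by (simp add: field_simps)
  then show "norm (1 / real (F (n + 1))) \<le> (1 + Q) / (1 - Q) * q ^ n" by simp
qed

lemma convergent_prod_plus: "convergent_prod (\<lambda>n. 1 + 1 / real (F (n + 1)))"
  and convergent_prod_minus: "convergent_prod (\<lambda>n. 1 - 1 / real (F (n + 3)))"
proof -
  have "summable (\<lambda>n. 1 / real (F (n + 3)))"
    using summable_inverse_fib summable_iff_shift[of "\<lambda>n. 1 / real (F (n + 1))" 2]
    by (simp add: numeral_3_eq_3)
  then show "convergent_prod (\<lambda>n. 1 + 1 / real (F (n + 1)))" "convergent_prod (\<lambda>n. 1 - 1 / real (F (n + 3)))"
    using summable_inverse_fib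
    by (auto intro!: abs_convergent_prod_imp_convergent_prod summable_imp_abs_convergent_prod)
qed

text \<open>The telescoped part tends to \<open>1 / (1 - Q) = 1 / q\<close>, and the 4 is the square
  of the 2 in \<open>qpoch (- 1) Q = 2 * qpoch (- Q) Q\<close>.\<close>

lemma prodinf_plus:
  "(\<Prod>n. 1 + 1 / real (F (n + 1))) = 4 * (qpoch (- Q) Q)\<^sup>2 / (q * qpoch (- Q) (Q\<^sup>2))"
proof -
  have Q: "norm Q < 1" "norm (Q\<^sup>2) < 1"
    using Q_pos Q_less_1 by (simp_all add: power_less_one_iff)
  have part: "(\<Prod>k<2 * n. 1 + 1 / real (F (k + 1))) =
      (\<Prod>m<n. 1 - (- 1) * Q ^ m)\<^sup>2 / (\<Prod>m<n. 1 - (- Q) * (Q\<^sup>2) ^ m) * ((1 - Q * Q ^ n) / (1 - Q))" for n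
  proof -
    have "(\<Prod>k<2 * n. 1 + 1 / real (F (k + 1))) =
        (\<Prod>m<n. (1 + Q ^ m)\<^sup>2 / (1 + Q * (Q ^ m)\<^sup>2) * ((1 - Q * (Q * Q ^ m)) / (1 - Q * Q ^ m)))"
      unfolding prod_lessThan_double fib_factor_plus [symmetric] by simp
    also have "\<dots> = (\<Prod>m<n. 1 + Q ^ m)\<^sup>2 / (\<Prod>m<n. 1 + Q * (Q ^ m)\<^sup>2) *
        (\<Prod>m<n. (1 - Q * Q ^ Suc m) / (1 - Q * Q ^ m))"
      by (simp only: prod.distrib prod_dividef prod_power_distrib power_Suc)
    also have "(\<Prod>m<n. (1 - Q * Q ^ Suc m) / (1 - Q * Q ^ m)) = (1 - Q * Q ^ n) / (1 - Q * Q ^ 0)"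
      using Q_power_bounds(3) by (intro prod_lessThan_telescope) (simp add: less_imp_neq)
    finally show ?thesis by (simp add: mult.commute flip: power_mult)
  qed
  have "qpoch (- 1) Q = 2 * qpoch (- Q) Q" using qpoch_rec[OF Q(1), of "- 1"] by simp
  moreover have "(\<lambda>n. \<Prod>k<2 * n. 1 + 1 / real (F (k + 1))) \<longlonglongrightarrow>
      (qpoch (- 1) Q)\<^sup>2 / qpoch (- Q) (Q\<^sup>2) * ((1 - Q * 0) / (1 - Q))"
    unfolding part using Q Q_less_1
    by (intro tendsto_intros LIMSEQ_qpoch LIMSEQ_power_zero qpoch_nonzero) auto
  ultimately show ?thesis
    using prodinf_eqI_even_partial_products[OF convergent_prod_plus] Q_eq by (simp add: power_mult_distrib mult_ac)
qed

lemma prodinf_minus: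
  "(\<Prod>n. 1 - 1 / real (F (n + 3))) = sqrt 5 / 3 * (qpoch Q Q)\<^sup>2 / (q * qpoch (- Q) (Q\<^sup>2))"
proof -
  have Q: "norm Q < 1" "norm (Q\<^sup>2) < 1"
    using Q_pos Q_less_1 by (simp_all add: power_less_one_iff)
  have pos: "1 + x \<noteq> 0" if "x > 0" for x :: real using that by simp
  have part: "(\<Prod>k<2 * n. 1 - 1 / real (F (k + 3))) =
      (\<Prod>m<n. 1 - Q * Q ^ m)\<^sup>2 / (\<Prod>m<n. 1 - (- Q * Q\<^sup>2) * (Q\<^sup>2) ^ m) *
      ((1 + Q\<^sup>2 * Q ^ n) / (1 + Q\<^sup>2))" for n
  proof -
    \<comment> \<open>Starting at \<open>F 3\<close> shifts \<open>m\<close> to \<open>Suc m\<close>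
      in \<open>fib_factor_minus\<close>; the denominator product therefore begins at
      \<open>Q^3\<close> and lacks the factor \<open>1 + Q\<close>, which \<open>D\<close>
      restores.\<close>
    have "(\<Prod>k<2 * n. 1 - 1 / real (F (k + 3))) =
        (\<Prod>m<n. (1 - Q ^ Suc m)\<^sup>2 / (1 + Q * (Q ^ Suc m)\<^sup>2) * ((1 + Q * (Q * Q ^ Suc m)) / (1 + Q * Q ^ Suc m)))"
      unfolding prod_lessThan_double fib_factor_minus [symmetric]
      by (simp add: numeral_3_eq_3)
    also have "\<dots> = (\<Prod>m<n. 1 - Q * Q ^ m)\<^sup>2 / (\<Prod>m<n. 1 + Q * (Q * Q ^ m)\<^sup>2) *
        (\<Prod>m<n. (1 + Q * (Q * Q ^ Suc m)) / (1 + Q * (Q * Q ^ m)))"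
      by (simp only: prod.distrib prod_dividef prod_power_distrib power_Suc)
    also have "(\<Prod>m<n. (1 + Q * (Q * Q ^ Suc m)) / (1 + Q * (Q * Q ^ m))) =
        (1 + Q * (Q * Q ^ n)) / (1 + Q * (Q * Q ^ 0))"
      using Q_pos by (intro prod_lessThan_telescope pos) simp
    also have "(\<Prod>m<n. 1 + Q * (Q * Q ^ m)\<^sup>2) = (\<Prod>m<n. 1 - (- Q * Q\<^sup>2) * (Q\<^sup>2) ^ m)"
      by (simp add: power2_eq_square power_mult_distrib mult_ac)
    finally show ?thesis by (simp add: power2_eq_square mult_ac)
  qed
  have "norm (- Q * Q\<^sup>2) < 1"
    using Q_pos Q_less_1 power_less_one_iff[of Q 3] by (simp add: power2_eq_square power3_eq_cube)
  then have "(\<lambda>n. \<Prod>k<2 * n. 1 - 1 / real (F (k + 3))) \<longlonglongrightarrow>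
      (qpoch Q Q)\<^sup>2 / qpoch (- Q * Q\<^sup>2) (Q\<^sup>2) * ((1 + Q\<^sup>2 * 0) / (1 + Q\<^sup>2))"
    unfolding part using Q pos[of "Q\<^sup>2"] Q_pos
    by (intro tendsto_intros LIMSEQ_qpoch LIMSEQ_power_zero qpoch_nonzero) auto
  then have prod: "(\<Prod>n. 1 - 1 / real (F (n + 3))) =
      (qpoch Q Q)\<^sup>2 / (qpoch (- Q * Q\<^sup>2) (Q\<^sup>2) * (1 + Q\<^sup>2))"
    using prodinf_eqI_even_partial_products[OF convergent_prod_minus] by simp
  have D: "qpoch (- Q) (Q\<^sup>2) = (1 + Q) * qpoch (- Q * Q\<^sup>2) (Q\<^sup>2)"
    using qpoch_rec[OF Q(2), of "- Q"] by simp
  \<comment> \<open>Together with \<open>Q1\<close> this evaluates the constant: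
    \<open>(1 + Q) / (1 + Q^2) = sqrt 5 / (3 q)\<close>.\<close>
  have Q2: "1 + Q\<^sup>2 = 3 * (q * q)"
    unfolding Q_eq using q_sq by (simp add: power2_eq_square algebra_simps)
  have Q1: "1 + Q = sqrt 5 * q"
    unfolding Q_eq unfolding q_def by (simp add: field_simps)
  show ?thesis
    unfolding prod D Q1 Q2 using q_pos by (simp add: mult_ac)
qed

end

section \<open>Passage from \<open>q\<close>-products to theta functions\<close>

theorem theorem1:
  fixes F :: "nat \<Rightarrow> nat" and \<beta> :: real
  assumes "F 0 = 0" and "F 1 = 1"
    and "\<And>n. F (n + 2) = F (n + 1) + F n"
    and "\<beta> = (sqrt 5 - 1) / 2"
  shows "convergent_prod (\<lambda>n. 1 + 1 / real (F (n + 1)))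
    \<and> complex_of_real (\<Prod>n. 1 + 1 / real (F (n + 1))) =
        2 * complex_of_real (\<beta> powr (-5/4)) *
          (jtheta2 (complex_of_real \<beta>) / jtheta4 (complex_of_real (\<beta> ^ 4)))
    \<and> convergent_prod (\<lambda>n. 1 - 1 / real (F (n + 3)))
    \<and> complex_of_real (\<Prod>n. 1 - 1 / real (F (n + 3))) =
        complex_of_real (sqrt 5 / 6) * complex_of_real (\<beta> powr (-5/4)) *
          (jtheta2 (complex_of_real \<beta>) * jtheta3 (complex_of_real \<beta>) * jtheta4 (complex_of_real \<beta>)
            / jtheta4 (complex_of_real (\<beta> ^ 4)))"
proof -
  interpret golden_fib F \<beta> by unfold_locales fact+
  define A where "A = qpoch (- Q) Q"
  define B where "B = qpoch Q Q"
  define D where "D = qpoch (- Q) (Q\<^sup>2)"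
  have nq: "norm (complex_of_real \<beta>) < 1" "complex_of_real \<beta> \<noteq> 0"
    using q_pos q_less_1 by simp_all
  have Q: "\<bar>Q\<bar> < 1" "\<bar>Q\<^sup>2\<bar> < 1"
    using Q_pos Q_less_1 by (simp_all add: power_less_one_iff)
  have "B \<noteq> 0" unfolding B_def using Q by (intro qpoch_nonzero) auto
  \<comment> \<open>For a positive base the principal complex power is the real one.\<close>
  have root: "complex_of_real \<beta> powr (1/4) = of_real (\<beta> powr (1/4))"
    using q_pos powr_of_real[of \<beta> "1/4"] by simp
  have A': "qpoch (- ((complex_of_real \<beta>)\<^sup>2)) ((complex_of_real \<beta>)\<^sup>2) = of_real A"
    and B': "qpoch ((complex_of_real \<beta>)\<^sup>2) ((complex_of_real \<beta>)\<^sup>2) = of_real B"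
    and D': "qpoch (- ((complex_of_real \<beta>)\<^sup>2)) (((complex_of_real \<beta>)\<^sup>2)\<^sup>2) = of_real D"
    using qpoch_of_real[OF Q(1), of "- Q"] qpoch_of_real[OF Q(1), of Q] qpoch_of_real[OF Q(2), of "- Q"]
    by (simp_all add: A_def B_def D_def Q_def)
  have t2: "jtheta2 (complex_of_real \<beta>) = of_real (2 * \<beta> powr (1/4) * (B * A\<^sup>2))"
    and t234: "jtheta2 (complex_of_real \<beta>) * jtheta3 (complex_of_real \<beta>) * jtheta4 (complex_of_real \<beta>) =
      of_real (2 * \<beta> powr (1/4) * B ^ 3)"
    and t4: "jtheta4 (complex_of_real (\<beta> ^ 4)) = of_real (B * D)"
    using jtheta2_product[OF nq] jtheta234_product[OF nq] jtheta4_power4_product[OF nq]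
    unfolding A' B' D' root by simp_all
  have pw: "\<beta> powr (-5/4) * \<beta> powr (1/4) = 1 / \<beta>"
    unfolding powr_add [symmetric] using q_pos by (simp add: powr_minus_divide)
  \<comment> \<open>The quotient is expanded by \<open>B\<close> to match the theta products, and
    \<open>1 / \<beta>\<close> is split by \<open>pw\<close> into the prefactor and the fourth root
    in \<open>jtheta2\<close>.\<close>
  have "(\<Prod>n. 1 + 1 / real (F (n + 1))) = 4 * (\<beta> powr (-5/4) * \<beta> powr (1/4)) * (B * A\<^sup>2 / (B * D))"
    unfolding pw using prodinf_plus \<open>B \<noteq> 0\<close> by (simp add: A_def D_def)
  then have "complex_of_real (\<Prod>n. 1 + 1 / real (F (n + 1))) =
      of_real (2 * \<beta> powr (-5/4) * ((2 * \<beta> powr (1/4) * (B * A\<^sup>2)) / (B * D)))"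
    by (simp add: mult_ac)
  moreover have "(\<Prod>n. 1 - 1 / real (F (n + 3))) =
      sqrt 5 / 3 * (\<beta> powr (-5/4) * \<beta> powr (1/4)) * (B ^ 3 / (B * D))"
    unfolding pw using prodinf_minus \<open>B \<noteq> 0\<close>
    by (simp add: B_def D_def power2_eq_square power3_eq_cube)
  then have "complex_of_real (\<Prod>n. 1 - 1 / real (F (n + 3))) =
      of_real (sqrt 5 / 6 * \<beta> powr (-5/4) * ((2 * \<beta> powr (1/4) * B ^ 3) / (B * D)))"
    by (simp add: mult_ac)
  \<comment> \<open>\<open>t234\<close> has to be unfolded before \<open>t2\<close>, whose left-hand
    side occurs inside it.\<close>
  ultimately show ?thesis
    using convergent_prod_plus convergent_prod_minus unfolding t234 t4 unfolding t2
    by (simp only: of_real_mult of_real_divide of_real_numeral)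
qed

end
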